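(* Let $U,V,W$ be complex vector spaces of dimensions $m,n,k$ respectively, and fix $r\ge 1$. Let $c=(c_0,\dots,c_{m-1})$ be the vector defined by $c_j=r\binom{m-1}{j}$ for $0\le j\le m-1$. Then $$\sigma_r\bigl(\mathrm{Seg}(\mathbb{P}U^*\times\mathbb{P}V^*\times\mathbb{P}W^* )\bigr)\subseteq\Sigma_{\kappa\le c}.$$
   Context: $\sigma_r(\mathrm{Seg}(\mathbb{P}U^*\times\mathbb{P}V^*\times\mathbb{P}W^* ))$ is the $r$th secant variety of the Segre variety, i.e. the Zariski closure in $\mathbb{P}(U^*\otimes V^*\otimes W^* )$ of the set of tensors of rank at most $r$. For $x\in U^*\otimes V^*\otimes W^*$ and $0\le j\le m-1$, the exterior flattening is the linear map $\psi_{j,x}\colon V\otimes\bigwedge^jU^*\to W^*\otimes\bigwedge^{j+1}U^*$, depending linearly on $x$, determined for $x=u\otimes v^*\otimes w^*$ by $\psi_{j,x}(v\otimes\omega)=v^*(v)\,w^*\otimes(u\wedge\omega)$. After choosing bases it is a matrix whose entries are linear forms in the polynomial ring $S^\bullet(U\otimes V\otimes W)$ on the affine space $U^*\otimes V^*\otimes W^*$. For a vector $c=(c_0,\dots,c_{m-1})$ of positive integers, $I_{\kappa_j\le c_j}$ is the ideal of $S^\bullet(U\otimes V\otimes W)$ generated by the $(c_j+1)\times(c_j+1)$ minors of $\psi_{j,x}$, $I_{\kappa\le c}$ is the ideal generated by all $I_{\kappa_j\le c_j}$, $0\le j\le m-1$, and $\Sigma_{\kappa\le c}$ is the subscheme of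 $\mathbb{P}(U^*\otimes V^*\otimes W^* )$ defined by $I_{\kappa\le c}$. *)

theory Defs
  imports
    "HOL-Library.Poly_Mapping"
    "HOL-Library.Cardinality"
    "Jordan_Normal_Form.Determinant"
begin

text \<open>A complex vector space is an abelian group type with a scaling \<open>s\<close> by complex numbers.
  The basis is indexed by a finite type, so that the dimension is the cardinality of that type.\<close>

definition is_basis :: "(complex \<Rightarrow> 'a::ab_group_add \<Rightarrow> 'a) \<Rightarrow> ('i::finite \<Rightarrow> 'a) \<Rightarrow> bool" where
  "is_basis s b \<longleftrightarrow> finite_dimensional_vector_space s (range b) \<and> inj b"

definition dual_space :: "(complex \<Rightarrow> 'a::ab_group_add \<Rightarrow> 'a) \<Rightarrow> ('a \<Rightarrow> complex) set" where
  "dual_space s = {f. Vector_Spaces.linear s (*) f}"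

definition dual_basis :: "(complex \<Rightarrow> 'a::ab_group_add \<Rightarrow> 'a) \<Rightarrow> ('i::finite \<Rightarrow> 'a) \<Rightarrow> 'i \<Rightarrow> 'a \<Rightarrow> complex" where
  "dual_basis s b i v = Modules.module.representation s (range b) v (b i)"


section \<open>Tensors\<close>

type_synonym ('u, 'v, 'w) tensor = "'u \<Rightarrow> 'v \<Rightarrow> 'w \<Rightarrow> complex"

text \<open>For finite-dimensional spaces, \<open>U\<^sup>* \<otimes> V\<^sup>* \<otimes> W\<^sup>*\<close> is the space of trilinear forms on
  \<open>U \<times> V \<times> W\<close>.\<close>

definition tensor_space ::
  "(complex \<Rightarrow> 'u::ab_group_add \<Rightarrow> 'u) \<Rightarrow> (complex \<Rightarrow> 'v::ab_group_add \<Rightarrow> 'v) \<Rightarrow>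
   (complex \<Rightarrow> 'w::ab_group_add \<Rightarrow> 'w) \<Rightarrow> ('u, 'v, 'w) tensor set" where
  "tensor_space sU sV sW = {x.
     (\<forall>b c. (\<lambda>a. x a b c) \<in> dual_space sU) \<and>
     (\<forall>a c. (\<lambda>b. x a b c) \<in> dual_space sV) \<and>
     (\<forall>a b. (\<lambda>c. x a b c) \<in> dual_space sW)}"

definition pure_tensor :: "('u \<Rightarrow> complex) \<Rightarrow> ('v \<Rightarrow> complex) \<Rightarrow> ('w \<Rightarrow> complex) \<Rightarrow> ('u, 'v, 'w) tensor" where
  "pure_tensor u v w = (\<lambda>a b c. u a * v b * w c)"

definition is_sum_of_pure_tensors ::
  "(complex \<Rightarrow> 'u::ab_group_add \<Rightarrow> 'u) \<Rightarrow> (complex \<Rightarrow> 'v::ab_group_add \<Rightarrow> 'v) \<Rightarrow>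
   (complex \<Rightarrow> 'w::ab_group_add \<Rightarrow> 'w) \<Rightarrow> nat \<Rightarrow> ('u, 'v, 'w) tensor \<Rightarrow> bool" where
  "is_sum_of_pure_tensors sU sV sW s x \<longleftrightarrow>
     (\<exists>u v w. (\<forall>i<s. u i \<in> dual_space sU \<and> v i \<in> dual_space sV \<and> w i \<in> dual_space sW) \<and>
        x = (\<lambda>a b c. \<Sum>i<s. pure_tensor (u i) (v i) (w i) a b c))"

definition tensor_rank ::
  "(complex \<Rightarrow> 'u::ab_group_add \<Rightarrow> 'u) \<Rightarrow> (complex \<Rightarrow> 'v::ab_group_add \<Rightarrow> 'v) \<Rightarrow>
   (complex \<Rightarrow> 'w::ab_group_add \<Rightarrow> 'w) \<Rightarrow> ('u, 'v, 'w) tensor \<Rightarrow> nat" where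
  "tensor_rank sU sV sW x = (LEAST s. is_sum_of_pure_tensors sU sV sW s x)"


section \<open>The polynomial ring on the space of tensors\<close>

type_synonym 'i mpoly = "('i \<Rightarrow>\<^sub>0 nat) \<Rightarrow>\<^sub>0 complex"

definition mvar :: "'i \<Rightarrow> 'i mpoly" where
  "mvar i = Poly_Mapping.single (Poly_Mapping.single i 1) 1"

definition mconst :: "complex \<Rightarrow> 'i mpoly" where
  "mconst z = Poly_Mapping.single 0 z"

definition mpoly_eval :: "'i mpoly \<Rightarrow> ('i \<Rightarrow> complex) \<Rightarrow> complex" where
  "mpoly_eval f x =
     (\<Sum>\<mu>\<in>Poly_Mapping.keys f. Poly_Mapping.lookup f \<mu> *
        (\<Prod>i\<in>Poly_Mapping.keys \<mu>. x i ^ Poly_Mapping.lookup \<mu> i))"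

definition homogeneous_of_degree :: "nat \<Rightarrow> 'i mpoly \<Rightarrow> bool" where
  "homogeneous_of_degree d f \<longleftrightarrow>
     (\<forall>\<mu>\<in>Poly_Mapping.keys f. (\<Sum>i\<in>Poly_Mapping.keys \<mu>. Poly_Mapping.lookup \<mu> i) = d)"

definition homogeneous :: "'i mpoly \<Rightarrow> bool" where
  "homogeneous f \<longleftrightarrow> (\<exists>d. homogeneous_of_degree d f)"

text \<open>An ideal is a submodule of the ring regarded as a module over itself.\<close>

definition ideal_generated :: "'i mpoly set \<Rightarrow> 'i mpoly set" where
  "ideal_generated G = Modules.module.span (*) G"

text \<open>The bases identify \<open>S\<^sup>\<bullet>(U \<otimes> V \<otimes> W)\<close> with the polynomial ring in the variables \<open>(i, p, q)\<close>;
  the variable \<open>(i, p, q)\<close> is the linear form sending a tensor to its value on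
  \<open>bU i \<otimes> bV p \<otimes> bW q\<close>.\<close>

definition coords ::
  "('m \<Rightarrow> 'u) \<Rightarrow> ('n \<Rightarrow> 'v) \<Rightarrow> ('k \<Rightarrow> 'w) \<Rightarrow> ('u, 'v, 'w) tensor \<Rightarrow> 'm \<times> 'n \<times> 'k \<Rightarrow> complex" where
  "coords bU bV bW x = (\<lambda>(i, p, q). x (bU i) (bV p) (bW q))"


section \<open>The projective space of tensors and the secant varieties of the Segre variety\<close>

text \<open>A point of the projective space is a one-dimensional subspace of the space of tensors.\<close>

definition line_through :: "('u, 'v, 'w) tensor \<Rightarrow> ('u, 'v, 'w) tensor set" where
  "line_through x = {(\<lambda>a b c. z * x a b c) | z. True}"

definition projective_space ::
  "(complex \<Rightarrow> 'u::ab_group_add \<Rightarrow> 'u) \<Rightarrow> (complex \<Rightarrow> 'v::ab_group_add \<Rightarrow> 'v) \<Rightarrow>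
   (complex \<Rightarrow> 'w::ab_group_add \<Rightarrow> 'w) \<Rightarrow> ('u, 'v, 'w) tensor set set" where
  "projective_space sU sV sW =
     line_through ` {x \<in> tensor_space sU sV sW. x \<noteq> (\<lambda>a b c. 0)}"

text \<open>A polynomial vanishes at a point of the projective space if it vanishes on the whole line,
  equivalently if all of its homogeneous components do.\<close>

definition vanishes_at ::
  "('m \<Rightarrow> 'u) \<Rightarrow> ('n \<Rightarrow> 'v) \<Rightarrow> ('k \<Rightarrow> 'w) \<Rightarrow> ('m \<times> 'n \<times> 'k) mpoly \<Rightarrow>
   ('u, 'v, 'w) tensor set \<Rightarrow> bool" where
  "vanishes_at bU bV bW f P \<longleftrightarrow> (\<forall>x\<in>P. mpoly_eval f (coords bU bV bW x) = 0)"

definition zariski_closed ::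
  "(complex \<Rightarrow> 'u::ab_group_add \<Rightarrow> 'u) \<Rightarrow> (complex \<Rightarrow> 'v::ab_group_add \<Rightarrow> 'v) \<Rightarrow>
   (complex \<Rightarrow> 'w::ab_group_add \<Rightarrow> 'w) \<Rightarrow>
   ('m \<Rightarrow> 'u) \<Rightarrow> ('n \<Rightarrow> 'v) \<Rightarrow> ('k \<Rightarrow> 'w) \<Rightarrow> ('u, 'v, 'w) tensor set set \<Rightarrow> bool" where
  "zariski_closed sU sV sW bU bV bW Z \<longleftrightarrow>
     (\<exists>F. (\<forall>f\<in>F. homogeneous f) \<and>
        Z = {P \<in> projective_space sU sV sW. \<forall>f\<in>F. vanishes_at bU bV bW f P})"

definition zariski_closure ::
  "(complex \<Rightarrow> 'u::ab_group_add \<Rightarrow> 'u) \<Rightarrow> (complex \<Rightarrow> 'v::ab_group_add \<Rightarrow> 'v) \<Rightarrow>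
   (complex \<Rightarrow> 'w::ab_group_add \<Rightarrow> 'w) \<Rightarrow>
   ('m \<Rightarrow> 'u) \<Rightarrow> ('n \<Rightarrow> 'v) \<Rightarrow> ('k \<Rightarrow> 'w) \<Rightarrow> ('u, 'v, 'w) tensor set set \<Rightarrow>
   ('u, 'v, 'w) tensor set set" where
  "zariski_closure sU sV sW bU bV bW X =
     \<Inter>{Z. zariski_closed sU sV sW bU bV bW Z \<and> X \<subseteq> Z}"

definition secant_variety_segre ::
  "(complex \<Rightarrow> 'u::ab_group_add \<Rightarrow> 'u) \<Rightarrow> (complex \<Rightarrow> 'v::ab_group_add \<Rightarrow> 'v) \<Rightarrow>
   (complex \<Rightarrow> 'w::ab_group_add \<Rightarrow> 'w) \<Rightarrow>
   ('m \<Rightarrow> 'u) \<Rightarrow> ('n \<Rightarrow> 'v) \<Rightarrow> ('k \<Rightarrow> 'w) \<Rightarrow> nat \<Rightarrow> ('u, 'v, 'w) tensor set set" where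
  "secant_variety_segre sU sV sW bU bV bW r =
     zariski_closure sU sV sW bU bV bW
       (line_through ` {x \<in> tensor_space sU sV sW.
          x \<noteq> (\<lambda>a b c. 0) \<and> tensor_rank sU sV sW x \<le> r})"


section \<open>Closed subschemes of projective space\<close>

text \<open>Closed subschemes of a projective space correspond, by reversal of inclusion, to saturated
  homogeneous ideals of its homogeneous coordinate ring. The subscheme defined by a homogeneous
  ideal is therefore represented by the saturation of that ideal with respect to the irrelevant
  ideal.\<close>

definition saturation :: "'i mpoly set \<Rightarrow> 'i mpoly set" where
  "saturation I = {f. \<exists>d. \<forall>g. homogeneous_of_degree d g \<longrightarrow> g * f \<in> I}"

type_synonym 'i subscheme = "'i mpoly set"

definition subscheme_defined_by :: "'i mpoly set \<Rightarrow> 'i subscheme" where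
  "subscheme_defined_by I = saturation I"

definition subscheme_contained :: "'i subscheme \<Rightarrow> 'i subscheme \<Rightarrow> bool" where
  "subscheme_contained X Y \<longleftrightarrow> Y \<subseteq> X"

definition vanishing_ideal ::
  "('m \<Rightarrow> 'u) \<Rightarrow> ('n \<Rightarrow> 'v) \<Rightarrow> ('k \<Rightarrow> 'w) \<Rightarrow> ('u, 'v, 'w) tensor set set \<Rightarrow>
   ('m \<times> 'n \<times> 'k) mpoly set" where
  "vanishing_ideal bU bV bW Z = {f. \<forall>P\<in>Z. vanishes_at bU bV bW f P}"

text \<open>A variety is regarded as a subscheme with its reduced structure.\<close>

definition reduced_subscheme ::
  "('m \<Rightarrow> 'u) \<Rightarrow> ('n \<Rightarrow> 'v) \<Rightarrow> ('k \<Rightarrow> 'w) \<Rightarrow> ('u, 'v, 'w) tensor set set \<Rightarrow>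
   ('m \<times> 'n \<times> 'k) subscheme" where
  "reduced_subscheme bU bV bW Z = subscheme_defined_by (vanishing_ideal bU bV bW Z)"


section \<open>Exterior flattenings\<close>

text \<open>\<open>\<Lambda>\<^sup>jU\<^sup>*\<close> is the space of alternating \<open>j\<close>-linear forms on \<open>U\<close>, a form being a function of the list
  of its \<open>j\<close> arguments. The product of a linear form \<open>u\<close> with a form \<open>\<omega>\<close> is normalised so that
  \<open>u\<^sub>1 \<and> \<dots> \<and> u\<^sub>j\<close> takes the value \<open>det (u\<^sub>p (x\<^sub>q))\<close> at \<open>[x\<^sub>1, \<dots>, x\<^sub>j]\<close>.\<close>

type_synonym 'u form = "'u list \<Rightarrow> complex"

definition wedge :: "('u \<Rightarrow> complex) \<Rightarrow> 'u form \<Rightarrow> 'u form" where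
  "wedge u \<omega> xs =
     (\<Sum>p<length xs. (-1) ^ p * u (xs ! p) * \<omega> (take p xs @ drop (Suc p) xs))"

text \<open>An element of \<open>W\<^sup>* \<otimes> \<Lambda>\<^sup>j\<^sup>+\<^sup>1U\<^sup>*\<close> is a linear map from \<open>W\<close> to the forms on \<open>U\<close>, and the
  flattening is given as a bilinear map in \<open>v\<close> and \<open>\<omega>\<close>; it is linear in \<open>x\<close>.\<close>

definition exterior_flattening ::
  "('u, 'v, 'w) tensor \<Rightarrow> 'v \<Rightarrow> 'u form \<Rightarrow> 'w \<Rightarrow> 'u form" where
  "exterior_flattening x v \<omega> = (\<lambda>w. wedge (\<lambda>a. x a v w) \<omega>)"

lemma exterior_flattening_pure_tensor:
  "exterior_flattening (pure_tensor u v' w') v \<omega> = (\<lambda>w xs. v' v * (w' w * wedge u \<omega> xs))"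
  by (simp add: fun_eq_iff exterior_flattening_def pure_tensor_def wedge_def sum_distrib_left mult_ac)

lemma exterior_flattening_linear:
  "exterior_flattening (\<lambda>a b c. z * x a b c + y a b c) v \<omega> =
     (\<lambda>w xs. z * exterior_flattening x v \<omega> w xs + exterior_flattening y v \<omega> w xs)"
  by (simp add: fun_eq_iff exterior_flattening_def wedge_def sum_distrib_left algebra_simps
      flip: sum.distrib)

text \<open>For \<open>S = {i\<^sub>1 < \<dots> < i\<^sub>j}\<close> this is \<open>e\<^sub>S = e\<^sub>i\<^sub>1 \<and> \<dots> \<and> e\<^sub>i\<^sub>j\<close>, where \<open>e\<close> is the basis dual to \<open>b\<close>.\<close>

definition basis_form ::
  "(complex \<Rightarrow> 'u::ab_group_add \<Rightarrow> 'u) \<Rightarrow> ('m::{finite,linorder} \<Rightarrow> 'u) \<Rightarrow> 'm set \<Rightarrow> 'u form" where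
  "basis_form s b S =
     foldr (\<lambda>i \<omega>. wedge (dual_basis s b i) \<omega>) (sorted_list_of_set S) (\<lambda>_. 1)"

text \<open>The matrix of the flattening of \<open>x\<close>: the column \<open>(p, S)\<close> stands for \<open>bV p \<otimes> e\<^sub>S\<close>, and the
  row \<open>(q, T)\<close> for the coefficient at the tensor product of the \<open>q\<close>-th vector of the basis dual to
  \<open>bW\<close> with \<open>e\<^sub>T\<close>. The coefficient of a form at \<open>e\<^sub>T\<close> is its value on the basis vectors indexed by
  \<open>T\<close> in increasing order.\<close>

definition flattening_coefficient ::
  "(complex \<Rightarrow> 'u::ab_group_add \<Rightarrow> 'u) \<Rightarrow>
   ('m::{finite,linorder} \<Rightarrow> 'u) \<Rightarrow> ('n \<Rightarrow> 'v) \<Rightarrow> ('k \<Rightarrow> 'w) \<Rightarrow> ('u, 'v, 'w) tensor \<Rightarrow>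
   'k \<times> 'm set \<Rightarrow> 'n \<times> 'm set \<Rightarrow> complex" where
  "flattening_coefficient sU bU bV bW x = (\<lambda>(q, T) (p, S).
     exterior_flattening x (bV p) (basis_form sU bU S) (bW q) (map bU (sorted_list_of_set T)))"

text \<open>The same entries as linear forms in the coordinates of a varying tensor.\<close>

definition flattening_matrix ::
  "(complex \<Rightarrow> 'u::ab_group_add \<Rightarrow> 'u) \<Rightarrow> (complex \<Rightarrow> 'v::ab_group_add \<Rightarrow> 'v) \<Rightarrow>
   (complex \<Rightarrow> 'w::ab_group_add \<Rightarrow> 'w) \<Rightarrow>
   ('m::{finite,linorder} \<Rightarrow> 'u) \<Rightarrow> ('n::finite \<Rightarrow> 'v) \<Rightarrow> ('k::finite \<Rightarrow> 'w) \<Rightarrow>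
   'k \<times> 'm set \<Rightarrow> 'n \<times> 'm set \<Rightarrow> ('m \<times> 'n \<times> 'k) mpoly" where
  "flattening_matrix sU sV sW bU bV bW R C =
     (\<Sum>(i, p, q)\<in>UNIV.
        mconst (flattening_coefficient sU bU bV bW
          (pure_tensor (dual_basis sU bU i) (dual_basis sV bV p) (dual_basis sW bW q)) R C)
        * mvar (i, p, q))"

definition minors ::
  "nat \<Rightarrow> 'a set \<Rightarrow> 'b set \<Rightarrow> ('a \<Rightarrow> 'b \<Rightarrow> 'c::comm_ring_1) \<Rightarrow> 'c set" where
  "minors N A B M =
     {Determinant.det (mat N N (\<lambda>(p, q). M (rs ! p) (cs ! q))) | rs cs.
        length rs = N \<and> distinct rs \<and> set rs \<subseteq> A \<and>
        length cs = N \<and> distinct cs \<and> set cs \<subseteq> B}"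

definition flattening_ideal_at ::
  "(complex \<Rightarrow> 'u::ab_group_add \<Rightarrow> 'u) \<Rightarrow> (complex \<Rightarrow> 'v::ab_group_add \<Rightarrow> 'v) \<Rightarrow>
   (complex \<Rightarrow> 'w::ab_group_add \<Rightarrow> 'w) \<Rightarrow>
   ('m::{finite,linorder} \<Rightarrow> 'u) \<Rightarrow> ('n::finite \<Rightarrow> 'v) \<Rightarrow> ('k::finite \<Rightarrow> 'w) \<Rightarrow>
   nat \<Rightarrow> nat \<Rightarrow> ('m \<times> 'n \<times> 'k) mpoly set" where
  "flattening_ideal_at sU sV sW bU bV bW j cj =
     ideal_generated (minors (cj + 1)
       (UNIV \<times> {T. card T = j + 1}) (UNIV \<times> {S. card S = j})
       (flattening_matrix sU sV sW bU bV bW))"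

definition flattening_ideal ::
  "(complex \<Rightarrow> 'u::ab_group_add \<Rightarrow> 'u) \<Rightarrow> (complex \<Rightarrow> 'v::ab_group_add \<Rightarrow> 'v) \<Rightarrow>
   (complex \<Rightarrow> 'w::ab_group_add \<Rightarrow> 'w) \<Rightarrow>
   ('m::{finite,linorder} \<Rightarrow> 'u) \<Rightarrow> ('n::finite \<Rightarrow> 'v) \<Rightarrow> ('k::finite \<Rightarrow> 'w) \<Rightarrow>
   (nat \<Rightarrow> nat) \<Rightarrow> ('m \<times> 'n \<times> 'k) mpoly set" where
  "flattening_ideal sU sV sW bU bV bW c =
     ideal_generated (\<Union>j\<in>{..<CARD('m)}. flattening_ideal_at sU sV sW bU bV bW j (c j))"

definition flattening_subscheme ::
  "(complex \<Rightarrow> 'u::ab_group_add \<Rightarrow> 'u) \<Rightarrow> (complex \<Rightarrow> 'v::ab_group_add \<Rightarrow> 'v) \<Rightarrow>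
   (complex \<Rightarrow> 'w::ab_group_add \<Rightarrow> 'w) \<Rightarrow>
   ('m::{finite,linorder} \<Rightarrow> 'u) \<Rightarrow> ('n::finite \<Rightarrow> 'v) \<Rightarrow> ('k::finite \<Rightarrow> 'w) \<Rightarrow>
   (nat \<Rightarrow> nat) \<Rightarrow> ('m \<times> 'n \<times> 'k) subscheme" where
  "flattening_subscheme sU sV sW bU bV bW c =
     subscheme_defined_by (flattening_ideal sU sV sW bU bV bW c)"

end

theory Submission
  imports Defs
begin

text \<open>Membership in the ideal of the reduced secant variety is tested on tensors of rank at most \<open>r\<close>,
  since the minors are homogeneous polynomials. For \<open>u \<noteq> 0\<close>, the map \<open>u \<and> _\<close> from \<open>\<Lambda>\<^sup>jU\<^sup>*\<close> has rank at
  most \<open>m - 1\<close> choose \<open>j\<close>, and so has the flattening of \<open>u \<otimes> v \<otimes> w\<close>. The flattening of a sum of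
  \<open>s \<le> r\<close> pure tensors therefore factors through a space of dimension at most \<open>c\<^sub>j\<close>, which makes its
  minors of size \<open>c\<^sub>j + 1\<close> vanish.\<close>

section \<open>Polynomials: evaluation, homogeneity, ideals\<close>

text \<open>The product runs over all variables rather than over \<open>keys \<mu>\<close>:
  variables with exponent 0 contribute 1, and a fixed index set makes evaluation multiplicative in
  \<mu>.\<close>

definition monom_eval :: "('i::finite \<Rightarrow>\<^sub>0 nat) \<Rightarrow> ('i \<Rightarrow> complex) \<Rightarrow> complex" where
  "monom_eval \<mu> x = (\<Prod>i\<in>UNIV. x i ^ Poly_Mapping.lookup \<mu> i)"

lemma monom_eval_add: "monom_eval (\<mu> + \<nu>) x = monom_eval \<mu> x * monom_eval \<nu> x"
  by (simp add: monom_eval_def lookup_add power_add prod.distrib)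

text \<open>Monomials outside the support have coefficient 0. This gives polynomials with different
  supports a common index set.\<close>

lemma mpoly_eval_superset:
  fixes f :: "'i::finite mpoly"
  assumes "finite A" "Poly_Mapping.keys f \<subseteq> A"
  shows "mpoly_eval f x = (\<Sum>\<mu>\<in>A. Poly_Mapping.lookup f \<mu> * monom_eval \<mu> x)"
proof -
  have "(\<Prod>i\<in>Poly_Mapping.keys \<mu>. x i ^ Poly_Mapping.lookup \<mu> i) = monom_eval \<mu> x" for \<mu>
    unfolding monom_eval_def by (rule prod.mono_neutral_left) (auto simp: in_keys_iff)
  then have "mpoly_eval f x = (\<Sum>\<mu>\<in>Poly_Mapping.keys f. Poly_Mapping.lookup f \<mu> * monom_eval \<mu> x)"
    by (simp add: mpoly_eval_def)
  also have "\<dots> = (\<Sum>\<mu>\<in>A. Poly_Mapping.lookup f \<mu> * monom_eval \<mu> x)"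
    by (rule sum.mono_neutral_left) (use assms in \<open>auto simp: in_keys_iff\<close>)
  finally show ?thesis .
qed

lemma mpoly_eval_add:
  fixes f g :: "'i::finite mpoly"
  shows "mpoly_eval (f + g) x = mpoly_eval f x + mpoly_eval g x"
proof -
  let ?A = "Poly_Mapping.keys f \<union> Poly_Mapping.keys g"
  have "Poly_Mapping.keys (f + g) \<subseteq> ?A"
    by (rule keys_add)
  then show ?thesis
    by (simp add: mpoly_eval_superset[of ?A] lookup_add distrib_right sum.distrib)
qed

lemma mpoly_eval_single: "mpoly_eval (Poly_Mapping.single \<mu> a) x = a * monom_eval \<mu> x"
  by (simp add: mpoly_eval_superset[of "{\<mu>}"])

lemma mpoly_eval_zero: "mpoly_eval 0 x = 0"
  by (simp add: mpoly_eval_def)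

lemma mpoly_eval_sum:
  fixes f :: "'a \<Rightarrow> 'i::finite mpoly"
  shows "mpoly_eval (sum f A) x = (\<Sum>a\<in>A. mpoly_eval (f a) x)"
  by (induction A rule: infinite_finite_induct) (auto simp: mpoly_eval_add mpoly_eval_zero)

lemma mpoly_sum_monomials:
  "(\<Sum>\<mu>\<in>Poly_Mapping.keys f. Poly_Mapping.single \<mu> (Poly_Mapping.lookup f \<mu>)) = f"
proof (rule poly_mapping_eqI)
  fix \<nu>
  have "Poly_Mapping.lookup (Poly_Mapping.single \<mu> (Poly_Mapping.lookup f \<mu>)) \<nu> =
      (if \<mu> = \<nu> then Poly_Mapping.lookup f \<mu> else 0)" for \<mu>
    by (simp add: lookup_single)
  then show "Poly_Mapping.lookup
      (\<Sum>\<mu>\<in>Poly_Mapping.keys f. Poly_Mapping.single \<mu> (Poly_Mapping.lookup f \<mu>)) \<nu> =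
      Poly_Mapping.lookup f \<nu>"
    by (simp add: lookup_sum in_keys_iff)
qed

text \<open>Both factors are expanded into monomials, so that bilinearity reduces the claim to
  \<open>monom_eval_add\<close>.\<close>

lemma mpoly_eval_mult:
  fixes f g :: "'i::finite mpoly"
  shows "mpoly_eval (f * g) x = mpoly_eval f x * mpoly_eval g x"
proof -
  let ?F = "\<lambda>\<mu>. Poly_Mapping.single \<mu> (Poly_Mapping.lookup f \<mu>)"
  let ?G = "\<lambda>\<mu>. Poly_Mapping.single \<mu> (Poly_Mapping.lookup g \<mu>)"
  let ?K = "Poly_Mapping.keys f" and ?L = "Poly_Mapping.keys g"
  have "mpoly_eval (sum ?F ?K * sum ?G ?L) x = mpoly_eval (sum ?F ?K) x * mpoly_eval (sum ?G ?L) x"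
    by (simp add: sum_product mpoly_eval_sum mult_single mpoly_eval_single monom_eval_add mult_ac)
  then show ?thesis
    by (simp only: mpoly_sum_monomials)
qed

lemma mpoly_eval_one: "mpoly_eval (1 :: 'i::finite mpoly) x = 1"
  using mpoly_eval_single[of 0 1 x] by (simp add: monom_eval_def)

lemma mpoly_eval_const: "mpoly_eval (mconst z :: 'i::finite mpoly) x = z"
  by (simp add: mconst_def mpoly_eval_single monom_eval_def)

lemma mpoly_eval_var: "mpoly_eval (mvar (i :: 'i::finite)) x = x i"
proof -
  have "x j ^ Poly_Mapping.lookup (Poly_Mapping.single i (1::nat)) j = (if j = i then x i else 1)" for j
    by (simp add: lookup_single)
  then show ?thesis
    by (simp add: mvar_def mpoly_eval_single monom_eval_def del: lookup_single_eq)
qed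

lemma comm_ring_hom_mpoly_eval: "comm_ring_hom (\<lambda>f :: 'i::finite mpoly. mpoly_eval f x)"
  by unfold_locales (simp_all add: mpoly_eval_add mpoly_eval_mult mpoly_eval_one mpoly_eval_zero)

lemma mpoly_eval_det:
  fixes f :: "nat \<times> nat \<Rightarrow> 'i::finite mpoly"
  shows "mpoly_eval (Determinant.det (mat N N f)) x = Determinant.det (mat N N (\<lambda>pq. mpoly_eval (f pq) x))"
proof -
  interpret comm_ring_hom "\<lambda>f :: 'i mpoly. mpoly_eval f x"
    by (rule comm_ring_hom_mpoly_eval)
  have "map_mat (\<lambda>f. mpoly_eval f x) (mat N N f) = mat N N (\<lambda>pq. mpoly_eval (f pq) x)"
    by (rule eq_matI) auto
  with hom_det[of "mat N N f"] show ?thesis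
    by simp
qed

section \<open>Homogeneous polynomials and determinants of linear forms\<close>

lemma homogeneous_of_degree_add:
  "homogeneous_of_degree d f \<Longrightarrow> homogeneous_of_degree d g \<Longrightarrow> homogeneous_of_degree d (f + g)"
  using keys_add[of f g] by (auto simp: homogeneous_of_degree_def)

lemma homogeneous_of_degree_zero: "homogeneous_of_degree d 0"
  by (simp add: homogeneous_of_degree_def)

lemma homogeneous_of_degree_sum:
  "(\<And>a. a \<in> A \<Longrightarrow> homogeneous_of_degree d (f a)) \<Longrightarrow> homogeneous_of_degree d (sum f A)"
  by (induction A rule: infinite_finite_induct)
    (auto intro: homogeneous_of_degree_add homogeneous_of_degree_zero)

lemma homogeneous_of_degree_uminus:
  "homogeneous_of_degree d f \<Longrightarrow> homogeneous_of_degree d (- f)"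
  by (auto simp: homogeneous_of_degree_def in_keys_iff)

lemma homogeneous_of_degree_mult:
  fixes f g :: "'i::finite mpoly"
  assumes "homogeneous_of_degree d f" "homogeneous_of_degree e g"
  shows "homogeneous_of_degree (d + e) (f * g)"
proof -
  \<comment> \<open>As for \<open>monom_eval\<close>, a sum over all variables makes the total
    degree visibly additive.\<close>
  have total: "(\<Sum>i\<in>Poly_Mapping.keys \<mu>. Poly_Mapping.lookup \<mu> i) =
      (\<Sum>i\<in>UNIV. Poly_Mapping.lookup \<mu> i)" for \<mu> :: "'i \<Rightarrow>\<^sub>0 nat"
    by (rule sum.mono_neutral_left) (auto simp: in_keys_iff)
  show ?thesis
    using assms keys_mult[of f g]
    by (fastforce simp: homogeneous_of_degree_def total lookup_add sum.distrib)
qed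

lemma homogeneous_of_degree_one: "homogeneous_of_degree 0 1"
  by (simp add: homogeneous_of_degree_def)

lemma homogeneous_of_degree_prod:
  fixes f :: "'a \<Rightarrow> 'i::finite mpoly"
  assumes "finite A" "\<And>a. a \<in> A \<Longrightarrow> homogeneous_of_degree 1 (f a)"
  shows "homogeneous_of_degree (card A) (prod f A)"
  using assms
proof (induction A rule: finite_induct)
  case empty
  then show ?case by (simp add: homogeneous_of_degree_one)
next
  case (insert a A)
  then show ?case
    using homogeneous_of_degree_mult[of 1 "f a" "card A" "prod f A"] by simp
qed

text \<open>Each term of the Leibniz expansion is, up to sign, a product of N linear
  entries.\<close>

lemma homogeneous_det:
  fixes f :: "nat \<times> nat \<Rightarrow> 'i::finite mpoly"
  assumes "\<And>pq. homogeneous_of_degree 1 (f pq)"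
  shows "homogeneous_of_degree N (Determinant.det (mat N N f))"
proof -
  have "homogeneous_of_degree N (of_int (sign p) * (\<Prod>i = 0..<N. mat N N f $$ (i, p i)))"
    if "p permutes {0..<N}" for p
  proof -
    have "homogeneous_of_degree (card {0..<N}) (\<Prod>i = 0..<N. mat N N f $$ (i, p i))"
      by (rule homogeneous_of_degree_prod)
        (use assms permutes_in_image[OF that] in auto)
    then show ?thesis
      by (auto simp: sign_def intro: homogeneous_of_degree_uminus)
  qed
  then show ?thesis
    by (subst det_def'[of _ N]) (auto intro!: homogeneous_of_degree_sum)
qed

text \<open>This includes z = 0, since the zero polynomial counts as homogeneous of every degree;
  hence zero entries of a flattening cause no exception.\<close>

lemma homogeneous_linear_form: "homogeneous_of_degree 1 (mconst z * mvar i)"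
  by (simp add: mconst_def mvar_def mult_single homogeneous_of_degree_def)

section \<open>Generated ideals and saturation\<close>

lemma ideal_generated_subset:
  fixes G J :: "'i mpoly set"
  assumes "G \<subseteq> J" "0 \<in> J" "\<And>f g. f \<in> J \<Longrightarrow> g \<in> J \<Longrightarrow> f + g \<in> J"
    and "\<And>h f. f \<in> J \<Longrightarrow> h * f \<in> J"
  shows "ideal_generated G \<subseteq> J"
proof -
  interpret ring_module: Modules.module "(*) :: 'i mpoly \<Rightarrow> 'i mpoly \<Rightarrow> 'i mpoly"
    by unfold_locales (auto simp: algebra_simps)
  show ?thesis
    unfolding ideal_generated_def
    by (rule ring_module.span_minimal) (use assms in \<open>auto intro: ring_module.subspaceI\<close>)
qed

text \<open>Serves at both levels of generation: for the minors of one flattening and for the union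
  of the resulting ideals over all j.\<close>

lemma ideal_generated_subset_vanishing_ideal:
  fixes bU :: "'m::finite \<Rightarrow> 'u" and bV :: "'n::finite \<Rightarrow> 'v" and bW :: "'k::finite \<Rightarrow> 'w"
  assumes "G \<subseteq> vanishing_ideal bU bV bW Z"
  shows "ideal_generated G \<subseteq> vanishing_ideal bU bV bW Z"
  by (rule ideal_generated_subset[OF assms])
    (auto simp: vanishing_ideal_def vanishes_at_def mpoly_eval_add mpoly_eval_mult mpoly_eval_zero)

lemma saturation_mono: "I \<subseteq> J \<Longrightarrow> saturation I \<subseteq> saturation J"
  by (auto simp: saturation_def)

section \<open>Vanishing of determinants\<close>

text \<open>The matrix factors through a space of dimension \<open>card K\<close>, which is smaller
  than N, so its rank is less than N.\<close>

lemma det_eq_0_if_factors: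
  fixes a :: "nat \<Rightarrow> 'k \<Rightarrow> 'a::comm_ring_1"
  assumes K: "finite K" "card K < N"
    and f: "\<And>p q. p < N \<Longrightarrow> q < N \<Longrightarrow> f (p, q) = (\<Sum>k\<in>K. a p k * b k q)"
  shows "Determinant.det (mat N N f) = 0"
proof -
  obtain h where h: "bij_betw h {..<card K} K"
    using ex_bij_betw_nat_finite[OF K(1)] by (auto simp: atLeast0LessThan)
  \<comment> \<open>Both factors are padded with zeros to size N, so that the determinant of the
    product is multiplicative.\<close>
  define A where "A = mat N N (\<lambda>(p, l). if l < card K then a p (h l) else 0)"
  define B where "B = mat N N (\<lambda>(l, q). if l < card K then b (h l) q else 0)"
  have carrier: "A \<in> carrier_mat N N" "B \<in> carrier_mat N N"
    by (simp_all add: A_def B_def)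
  have "mat N N f = A * B"
  proof (rule eq_matI)
    fix p q assume "p < dim_row (A * B)" "q < dim_col (A * B)"
    then have pq: "p < N" "q < N" by (simp_all add: A_def B_def)
    have "(A * B) $$ (p, q) =
        (\<Sum>l = 0..<N. if l < card K then a p (h l) * b (h l) q else 0)"
      using pq by (auto simp: A_def B_def scalar_prod_def intro!: sum.cong)
    also have "\<dots> = (\<Sum>l\<in>{..<card K}. a p (h l) * b (h l) q)"
      using K(2) by (intro sum.mono_neutral_cong_right) auto
    also have "\<dots> = (\<Sum>k\<in>K. a p k * b k q)"
      by (rule sum.reindex_bij_betw[OF h])
    finally show "mat N N f $$ (p, q) = (A * B) $$ (p, q)"
      using pq f by simp
  qed (simp_all add: A_def B_def)
  moreover have "Determinant.det B = 0"
  proof -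
    have "(\<Prod>i = 0..<N. B $$ (i, p i)) = 0" if "p permutes {0..<N}" for p
    proof (rule prod_zero)
      \<comment> \<open>Row \<open>card K\<close> of B exists because \<open>card K < N\<close>, and
        it consists of padding; every Leibniz term contains an entry of it.\<close>
      have "p (card K) < N"
        using permutes_in_image[OF that, of "card K"] K(2) by simp
      then show "\<exists>i\<in>{0..<N}. B $$ (i, p i) = 0"
        using K(2) by (intro bexI[of _ "card K"]) (auto simp: B_def)
    qed simp
    then show ?thesis
      by (simp add: det_def'[OF carrier(2)])
  qed
  ultimately show ?thesis
    by (simp add: det_mult[OF carrier])
qed

section \<open>The matrix of exterior multiplication by a linear form\<close>

text \<open>The coefficient of u \<and> e_S at e_T, where u is the sum of the u_t e_t. At most one t
  satisfies the condition, and the sign moves e_t to its place in the increasing order of T. Writing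
  it as a sum avoids choosing t and yields 0 if no t exists.\<close>

definition wedge_entry :: "('m::linorder \<Rightarrow> complex) \<Rightarrow> 'm set \<Rightarrow> 'm set \<Rightarrow> complex" where
  "wedge_entry u T S =
     (\<Sum>t\<in>T. if T - {t} = S then (-1) ^ card {x \<in> T. x < t} * u t else 0)"

lemma wedge_entry_insert:
  fixes u :: "'m::{finite,linorder} \<Rightarrow> complex"
  assumes "i \<notin> S"
  shows "wedge_entry u (insert i S) S = (-1) ^ card {x \<in> insert i S. x < i} * u i"
proof -
  have "wedge_entry u (insert i S) S =
      (\<Sum>t\<in>{i}. if insert i S - {t} = S then (-1) ^ card {x \<in> insert i S. x < t} * u t else 0)"
    unfolding wedge_entry_def by (rule sum.mono_neutral_right) (use assms in auto)
  then show ?thesis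
    using assms by simp
qed

lemma wedge_entry_neq_0D:
  assumes "wedge_entry u T S \<noteq> 0"
  obtains t where "t \<in> T" "S = T - {t}"
proof -
  have "\<exists>t\<in>T. T - {t} = S"
  proof (rule ccontr)
    assume "\<not> (\<exists>t\<in>T. T - {t} = S)"
    then have "wedge_entry u T S = 0"
      unfolding wedge_entry_def by (intro sum.neutral) auto
    with assms show False ..
  qed
  then show ?thesis using that by blast
qed

text \<open>The coordinate form of u \<and> u \<and> e_R = 0: two elements can be deleted from T in
  two orders, with opposite signs.\<close>

lemma wedge_entry_wedge_entry:
  fixes u :: "'m::{finite,linorder} \<Rightarrow> complex"
  shows "(\<Sum>S\<in>UNIV. wedge_entry u T S * wedge_entry u S R) = 0"
proof -
  let ?s = "\<lambda>t T. (-1) ^ card {x \<in> T. x < t} * u t"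
  \<comment> \<open>The contribution of deleting first t and then t' from T.\<close>
  define g where "g t t' =
    (if t' \<in> T - {t} \<and> T - {t} - {t'} = R then ?s t T * ?s t' (T - {t}) else 0)" for t t'
  have anti_less: "g t' t = - g t t'" if "t \<in> T" "t' \<in> T" "t < t'" for t t'
  proof -
    \<comment> \<open>Deleting t first lowers the number of elements below t' by one, while deleting
      t' first leaves the number below t unchanged.\<close>
    have "{x \<in> T. x < t'} = insert t {x \<in> T - {t}. x < t'}"
      using that by auto
    then have "card {x \<in> T. x < t'} = Suc (card {x \<in> T - {t}. x < t'})"
      by simp
    moreover have "{x \<in> T - {t'}. x < t} = {x \<in> T. x < t}"
      using that by auto
    moreover have "T - {t} - {t'} = T - {t'} - {t}"
      by auto
    ultimately show ?thesis
      using that by (auto simp: g_def)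
  qed
  have anti: "g t' t = - g t t'" if "t \<in> T" "t' \<in> T" for t t'
    using anti_less[of t t'] anti_less[of t' t] that
    by (cases t t' rule: linorder_cases) (auto simp: g_def)
  have "(\<Sum>S\<in>UNIV. wedge_entry u T S * wedge_entry u S R) =
      (\<Sum>S\<in>UNIV. \<Sum>t\<in>T. if T - {t} = S then ?s t T * wedge_entry u S R else 0)"
    by (auto simp: wedge_entry_def[of u T] sum_distrib_right intro!: sum.cong)
  also have "\<dots> = (\<Sum>t\<in>T. ?s t T * wedge_entry u (T - {t}) R)"
    by (subst sum.swap) simp
  also have "\<dots> = (\<Sum>t\<in>T. \<Sum>t'\<in>T. g t t')"
  proof (rule sum.cong[OF refl])
    fix t
    have "?s t T * wedge_entry u (T - {t}) R = (\<Sum>t'\<in>T - {t}. g t t')"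
      by (auto simp: wedge_entry_def sum_distrib_left g_def intro!: sum.cong split: if_splits)
    also have "\<dots> = (\<Sum>t'\<in>T. g t t')"
      by (rule sum.mono_neutral_left) (auto simp: g_def)
    finally show "?s t T * wedge_entry u (T - {t}) R = (\<Sum>t'\<in>T. g t t')" .
  qed
  finally have *: "(\<Sum>S\<in>UNIV. wedge_entry u T S * wedge_entry u S R) = (\<Sum>t\<in>T. \<Sum>t'\<in>T. g t t')" .
  \<comment> \<open>Interchanging the sums and using antisymmetry makes the double sum its own
    negative.\<close>
  have "(\<Sum>t\<in>T. \<Sum>t'\<in>T. g t t') = (\<Sum>t'\<in>T. \<Sum>t\<in>T. g t t')"
    by (rule sum.swap)
  also have "\<dots> = (\<Sum>t'\<in>T. \<Sum>t\<in>T. - g t' t)"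
    by (intro sum.cong refl anti)
  also have "\<dots> = - (\<Sum>t\<in>T. \<Sum>t'\<in>T. g t t')"
    by (simp add: sum_negf)
  finally show ?thesis
    unfolding * by simp
qed

text \<open>If \<open>u\<^sub>i \<noteq> 0\<close>, then \<open>u \<and> u \<and> e\<^sub>R = 0\<close> expresses \<open>u \<and> e\<^sub>i \<and> e\<^sub>R\<close> through the \<open>u \<and> e\<^sub>S\<close> with
  \<open>i \<notin> S\<close>.\<close>

lemma wedge_entry_factors:
  fixes u :: "'m::{finite,linorder} \<Rightarrow> complex"
  obtains G \<beta> where "card G \<le> (CARD('m) - 1) choose j"
    and "\<And>T S. card S = j \<Longrightarrow> wedge_entry u T S = (\<Sum>S'\<in>G. wedge_entry u T S' * \<beta> S' S)"
proof (cases "\<forall>i. u i = 0")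
  case True
  then show ?thesis
    by (intro that[of "{}"]) (auto simp: wedge_entry_def intro!: sum.neutral)
next
  case False
  then obtain i where i: "u i \<noteq> 0" by blast
  \<comment> \<open>The e_S with S in G span the image up to u \<and> _; there are (m - 1 choose j)
    of them.\<close>
  define G where "G = {S. S \<subseteq> UNIV - {i} \<and> card S = j}"
  \<comment> \<open>For i \<in> S the coefficients come from solving u \<and> u \<and> e_R = 0, with
    R = S - {i}, for the term of S; the divisor is u i up to sign. The other S lie in G and express
    themselves.\<close>
  define \<beta> where "\<beta> S' S =
    (if i \<in> S then - wedge_entry u S' (S - {i}) / wedge_entry u S (S - {i})
     else if S' = S then 1 else 0)" for S' S
  show ?thesis
  proof (rule that)
    show "card G \<le> (CARD('m) - 1) choose j"
      unfolding G_def by (simp add: n_subsets card_Diff_singleton)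
    fix T S :: "'m set" assume S: "card S = j"
    show "wedge_entry u T S = (\<Sum>S'\<in>G. wedge_entry u T S' * \<beta> S' S)"
    proof (cases "i \<in> S")
      case False
      then have "S \<in> G" using S by (auto simp: G_def)
      then show ?thesis
        using False by (simp add: \<beta>_def if_distrib cong: if_cong)
    next
      case True
      define R where "R = S - {i}"
      have SR: "S = insert i R" "i \<notin> R" using True by (auto simp: R_def)
      have nz: "wedge_entry u S R \<noteq> 0"
        using i by (simp add: SR wedge_entry_insert)
      have "0 = (\<Sum>S'\<in>UNIV. wedge_entry u T S' * wedge_entry u S' R)"
        by (simp add: wedge_entry_wedge_entry)
      also have "\<dots> = (\<Sum>S'\<in>insert S G. wedge_entry u T S' * wedge_entry u S' R)"
      proof (rule sum.mono_neutral_right)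
        show "\<forall>S'\<in>UNIV - insert S G. wedge_entry u T S' * wedge_entry u S' R = 0"
        proof
          fix S' assume S': "S' \<in> UNIV - insert S G"
          \<comment> \<open>Only sets obtained from R by adding one element t contribute: t = i
            gives S, and any other t gives a member of G.\<close>
          have "wedge_entry u S' R = 0"
          proof (rule ccontr)
            assume "wedge_entry u S' R \<noteq> 0"
            then obtain t where t: "t \<in> S'" "R = S' - {t}"
              by (rule wedge_entry_neq_0D)
            then have "S' = insert t R" "t \<notin> R" by auto
            moreover from this have "card S' = j"
              using S SR by simp
            ultimately show False
              using S' SR by (cases "t = i") (auto simp: G_def)
          qed
          then show "wedge_entry u T S' * wedge_entry u S' R = 0" by simp
        qed
      qed auto
      also have "\<dots> = wedge_entry u T S * wedge_entry u S R +
          (\<Sum>S'\<in>G. wedge_entry u T S' * wedge_entry u S' R)"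
        using True by (subst sum.insert) (auto simp: G_def)
      finally have "wedge_entry u T S * wedge_entry u S R =
          - (\<Sum>S'\<in>G. wedge_entry u T S' * wedge_entry u S' R)"
        by (simp add: eq_neg_iff_add_eq_0)
      then have "wedge_entry u T S =
          - (\<Sum>S'\<in>G. wedge_entry u T S' * wedge_entry u S' R) / wedge_entry u S R"
        using nz by (simp add: field_simps)
      then show ?thesis
        using True by (simp add: \<beta>_def R_def sum_divide_distrib sum_negf)
    qed
  qed
qed

section \<open>Values of alternating forms on basis vectors\<close>

text \<open>Expansion along the first factor, by induction on \<open>ss\<close>. The term at
  position p needs \<open>ts ! p = i\<close>; if p > 0, the head of \<open>ts\<close> is smaller
  than i and survives the deletion, while all of \<open>ss\<close> is larger than i, so the
  induction hypothesis gives 0. Stating it for strictly sorted lists keeps lists with a deleted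
  entry within the induction.\<close>

lemma wedge_foldr_strict_sorted:
  fixes ss ts :: "'m::linorder list"
  assumes dual: "\<And>i t. e i (b t) = (if t = i then 1 else 0)"
    and "sorted_wrt (<) ss" "sorted_wrt (<) ts" "length ts = length ss"
  shows "foldr (\<lambda>i \<omega>. wedge (e i) \<omega>) ss (\<lambda>_. 1) (map b ts) = (if ss = ts then 1 else 0)"
  using assms(2-)
proof (induction ss arbitrary: ts)
  case Nil
  then show ?case by simp
next
  case (Cons i ss)
  let ?F = "foldr (\<lambda>i \<omega>. wedge (e i) \<omega>) ss (\<lambda>_. 1)"
  obtain t ts' where ts: "ts = t # ts'"
    using Cons.prems(3) by (cases ts) auto
  have term0: "?F (map b (take p ts @ drop (Suc p) ts)) = 0"
    if p: "0 < p" "p < length ts" "ts ! p = i" for p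
  proof -
    obtain p' where p': "p = Suc p'" using p by (cases p) auto
    have "t < i"
      using p Cons.prems(2) nth_mem[of p' ts'] by (auto simp: ts p')
    then have "t \<notin> set ss"
      using Cons.prems(1) by (auto dest: order.asym)
    moreover have "t \<in> set (take p ts @ drop (Suc p) ts)"
      by (simp add: ts p')
    ultimately have "ss \<noteq> take p ts @ drop (Suc p) ts"
      by metis
    moreover have "sorted_wrt (<) (take p ts @ drop (Suc p) ts)"
    proof -
      have "sorted_wrt (<) (take p ts @ ts ! p # drop (Suc p) ts)"
        using Cons.prems(2) p(2) by (simp flip: id_take_nth_drop)
      then show ?thesis
        by (auto simp: sorted_wrt_append)
    qed
    moreover have "length (take p ts @ drop (Suc p) ts) = length ss"
      using Cons.prems(3) p by (simp add: ts p')
    ultimately show ?thesis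
      using Cons.IH[of "take p ts @ drop (Suc p) ts"] Cons.prems(1) by simp
  qed
  have "foldr (\<lambda>i \<omega>. wedge (e i) \<omega>) (i # ss) (\<lambda>_. 1) (map b ts) =
      (\<Sum>p<length ts. (-1) ^ p * (if ts ! p = i then 1 else 0) *
         ?F (map b (take p ts @ drop (Suc p) ts)))"
    by (simp add: wedge_def dual take_map drop_map)
  also have "\<dots> = (\<Sum>p\<in>{0}. (-1) ^ p * (if ts ! p = i then 1 else 0) *
         ?F (map b (take p ts @ drop (Suc p) ts)))"
    by (rule sum.mono_neutral_right) (use term0 in \<open>auto simp: ts\<close>)
  also have "\<dots> = (if i # ss = ts then 1 else 0)"
    using Cons.IH[of ts'] Cons.prems by (auto simp: ts)
  finally show ?case .
qed

lemma basis_form_basis: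
  fixes b :: "'m::{finite,linorder} \<Rightarrow> 'u::ab_group_add"
  assumes dual: "\<And>i t. dual_basis s b i (b t) = (if t = i then 1 else 0)"
    and "card S = card T"
  shows "basis_form s b S (map b (sorted_list_of_set T)) = (if T = S then 1 else 0)"
proof -
  have "basis_form s b S (map b (sorted_list_of_set T)) =
      (if sorted_list_of_set S = sorted_list_of_set T then 1 else 0)"
    unfolding basis_form_def
    by (rule wedge_foldr_strict_sorted[where e = "dual_basis s b" and b = b, OF dual])
      (use assms(2) in simp_all)
  then show ?thesis
    by (auto dest: sorted_list_of_set_inject)
qed

text \<open>Links forms to the combinatorial matrix. The p-th summand of \<open>wedge\<close>
  deletes the element t of T at position p; p counts the elements of T below t, and e_S detects
  whether what remains is S.\<close>

lemma wedge_basis_form: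
  fixes b :: "'m::{finite,linorder} \<Rightarrow> 'u::ab_group_add"
  assumes dual: "\<And>i t. dual_basis s b i (b t) = (if t = i then 1 else 0)"
    and card: "card T = Suc (card S)"
  shows "wedge u (basis_form s b S) (map b (sorted_list_of_set T)) = wedge_entry (u \<circ> b) T S"
proof -
  define ts where "ts = sorted_list_of_set T"
  have ts: "sorted_wrt (<) ts" "set ts = T" "distinct ts" "length ts = card T"
    by (simp_all add: ts_def)
  have "(-1) ^ p * u (map b ts ! p) *
        basis_form s b S (take p (map b ts) @ drop (Suc p) (map b ts)) =
      (if T - {ts ! p} = S then (-1) ^ card {x \<in> T. x < ts ! p} * (u \<circ> b) (ts ! p) else 0)"
    if p: "p < length ts" for p
  proof -
    have split: "ts = take p ts @ ts ! p # drop (Suc p) ts"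
      using p by (rule id_take_nth_drop)
    have sorted: "sorted_wrt (<) (take p ts @ ts ! p # drop (Suc p) ts)"
      using ts(1) split by simp
    have T: "T = set (take p ts) \<union> insert (ts ! p) (set (drop (Suc p) ts))"
      using arg_cong[OF split, of set] ts(2) by simp
    have "set (take p ts @ drop (Suc p) ts) = T - {ts ! p}"
      unfolding T using sorted by (auto simp: sorted_wrt_append)
    moreover have "sorted_wrt (<) (take p ts @ drop (Suc p) ts)"
      using sorted by (auto simp: sorted_wrt_append)
    ultimately have del: "take p ts @ drop (Suc p) ts = sorted_list_of_set (T - {ts ! p})"
      by (intro strict_sorted_equal) auto
    have "{x \<in> T. x < ts ! p} = set (take p ts)"
      unfolding T using sorted by (auto simp: sorted_wrt_append dest: order.asym)
    then have pos: "card {x \<in> T. x < ts ! p} = p"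
      using p ts(3) by (simp add: distinct_card)
    have "ts ! p \<in> T" using p ts(2) by auto
    then have "card S = card (T - {ts ! p})"
      using card by simp
    then have "basis_form s b S (take p (map b ts) @ drop (Suc p) (map b ts)) =
        (if T - {ts ! p} = S then 1 else 0)"
      by (simp add: basis_form_basis[where s = s and b = b, OF dual] take_map drop_map del
          flip: map_append)
    then show ?thesis
      using p pos by simp
  qed
  then have "wedge u (basis_form s b S) (map b ts) =
      (\<Sum>p<length ts. if T - {ts ! p} = S
         then (-1) ^ card {x \<in> T. x < ts ! p} * (u \<circ> b) (ts ! p) else 0)"
    by (simp add: wedge_def)
  also have "\<dots> = wedge_entry (u \<circ> b) T S"
    unfolding wedge_entry_def
    \<comment> \<open>Positions in the sorted list are exchanged for the elements of T.\<close>
    by (rule sum.reindex_bij_betw) (use ts in \<open>auto intro: bij_betw_nth\<close>)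
  finally show ?thesis
    by (simp add: ts_def)
qed

section \<open>Dual bases and tensor rank\<close>

lemma dual_basis_basis:
  assumes "is_basis s b"
  shows "dual_basis s b i (b t) = (if t = i then 1 else 0)"
proof -
  interpret finite_dimensional_vector_space s "range b"
    using assms by (simp add: is_basis_def)
  show ?thesis
    using assms by (auto simp: dual_basis_def representation_basis[OF independent_Basis]
        is_basis_def inj_eq)
qed

lemma dual_space_dual_basis:
  assumes "is_basis s b"
  shows "dual_basis s b i \<in> dual_space s"
proof -
  interpret finite_dimensional_vector_space s "range b"
    using assms by (simp add: is_basis_def)
  have "Modules.module ((*) :: complex \<Rightarrow> complex \<Rightarrow> complex)"
    by unfold_locales (auto simp: algebra_simps)
  then show ?thesis
    by (simp add: dual_space_def linear_iff_module_hom module_hom_iff module_axioms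
        dual_basis_def representation_add representation_scale independent_Basis span_Basis)
qed

lemma dual_space_scale:
  assumes "f \<in> dual_space s"
  shows "(\<lambda>a. z * f a) \<in> dual_space s"
  using assms by (simp add: dual_space_def linear_iff_module_hom module_hom_iff algebra_simps)

lemma dual_space_expansion:
  fixes b :: "'i::finite \<Rightarrow> 'a::ab_group_add"
  assumes "is_basis s b" "f \<in> dual_space s"
  shows "f a = (\<Sum>i\<in>UNIV. f (b i) * dual_basis s b i a)"
proof -
  interpret finite_dimensional_vector_space s "range b"
    using assms by (simp add: is_basis_def)
  interpret f: Vector_Spaces.linear s "(*)" f
    using assms(2) by (simp add: dual_space_def)
  have inj: "inj b"
    using assms by (simp add: is_basis_def)
  have "a = (\<Sum>v\<in>range b. s (representation (range b) a v) v)"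
    by (rule sum_representation_eq[symmetric]) (auto simp: independent_Basis span_Basis)
  also have "\<dots> = (\<Sum>i\<in>UNIV. s (dual_basis s b i a) (b i))"
    by (simp add: sum.reindex[OF inj] dual_basis_def)
  finally have "f a = f (\<Sum>i\<in>UNIV. s (dual_basis s b i a) (b i))"
    by simp
  then show ?thesis
    by (simp add: f.sum f.scale mult.commute)
qed

text \<open>The dual basis expansion is applied to one argument at a time, the others being fixed.
  It supplies the decomposition that makes the rank meaningful.\<close>

lemma tensor_expansion:
  fixes bU :: "'m::finite \<Rightarrow> 'u::ab_group_add" and bV :: "'n::finite \<Rightarrow> 'v::ab_group_add"
    and bW :: "'k::finite \<Rightarrow> 'w::ab_group_add"
  assumes "is_basis sU bU" "is_basis sV bV" "is_basis sW bW" "x \<in> tensor_space sU sV sW"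
  shows "x a b c = (\<Sum>(i, p, q)\<in>UNIV. x (bU i) (bV p) (bW q) *
    pure_tensor (dual_basis sU bU i) (dual_basis sV bV p) (dual_basis sW bW q) a b c)"
proof -
  have "x a b c = (\<Sum>i\<in>UNIV. x (bU i) b c * dual_basis sU bU i a)"
    using assms(4) by (intro dual_space_expansion[OF assms(1)]) (simp add: tensor_space_def)
  also have "\<dots> = (\<Sum>i\<in>UNIV. (\<Sum>p\<in>UNIV. x (bU i) (bV p) c * dual_basis sV bV p b) *
      dual_basis sU bU i a)"
    using assms(4) by (subst dual_space_expansion[OF assms(2), of "\<lambda>b. x _ b c"])
      (simp_all add: tensor_space_def)
  also have "\<dots> = (\<Sum>i\<in>UNIV. (\<Sum>p\<in>UNIV. (\<Sum>q\<in>UNIV. x (bU i) (bV p) (bW q) *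
      dual_basis sW bW q c) * dual_basis sV bV p b) * dual_basis sU bU i a)"
    using assms(4) by (subst dual_space_expansion[OF assms(3), of "\<lambda>c. x _ _ c"])
      (simp_all add: tensor_space_def)
  also have "\<dots> = (\<Sum>i\<in>UNIV. \<Sum>p\<in>UNIV. \<Sum>q\<in>UNIV. x (bU i) (bV p) (bW q) *
      pure_tensor (dual_basis sU bU i) (dual_basis sV bV p) (dual_basis sW bW q) a b c)"
    by (simp add: pure_tensor_def sum_distrib_left mult_ac)
  finally show ?thesis
    by (simp only: sum.cartesian_product UNIV_Times_UNIV)
qed

text \<open>\<^const>\<open>tensor_rank\<close> is a \<^const>\<open>Least\<close>, so a decomposition must exist before the rank means
  anything.\<close>

lemma is_sum_of_pure_tensors_tensor_rank:
  fixes bU :: "'m::finite \<Rightarrow> 'u::ab_group_add" and bV :: "'n::finite \<Rightarrow> 'v::ab_group_add"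
    and bW :: "'k::finite \<Rightarrow> 'w::ab_group_add"
  assumes bases: "is_basis sU bU" "is_basis sV bV" "is_basis sW bW"
    and x: "x \<in> tensor_space sU sV sW"
  shows "is_sum_of_pure_tensors sU sV sW (tensor_rank sU sV sW x) x"
  unfolding tensor_rank_def
proof (rule LeastI)
  let ?I = "UNIV :: ('m \<times> 'n \<times> 'k) set"
  obtain h where h: "bij_betw h {..<card ?I} ?I"
    using ex_bij_betw_nat_finite[of ?I] by (auto simp: atLeast0LessThan)
  \<comment> \<open>The coefficient of each basis tensor is absorbed into its first factor.\<close>
  define u where "u l = (case h l of (i, p, q) \<Rightarrow>
    \<lambda>a. x (bU i) (bV p) (bW q) * dual_basis sU bU i a)" for l
  define v where "v l = (case h l of (i, p, q) \<Rightarrow> dual_basis sV bV p)" for l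
  define w where "w l = (case h l of (i, p, q) \<Rightarrow> dual_basis sW bW q)" for l
  have "u l \<in> dual_space sU" "v l \<in> dual_space sV" "w l \<in> dual_space sW" for l
    using bases by (auto simp: u_def v_def w_def dual_space_dual_basis dual_space_scale
        split: prod.split)
  moreover have "x = (\<lambda>a b c. \<Sum>l<card ?I. pure_tensor (u l) (v l) (w l) a b c)"
  proof (intro ext)
    fix a b c
    show "x a b c = (\<Sum>l<card ?I. pure_tensor (u l) (v l) (w l) a b c)"
      unfolding tensor_expansion[OF bases x, of a b c]
      by (subst sum.reindex_bij_betw[OF h, symmetric])
        (auto simp: u_def v_def w_def pure_tensor_def split: prod.split intro!: sum.cong)
  qed
  ultimately show "is_sum_of_pure_tensors sU sV sW (card ?I) x"
    unfolding is_sum_of_pure_tensors_def by (intro exI[of _ u] exI[of _ v] exI[of _ w]) blast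
qed

section \<open>Minors of flattenings\<close>

lemma flattening_coefficient_pure_tensor:
  fixes bU :: "'m::{finite,linorder} \<Rightarrow> 'u::ab_group_add"
  assumes "is_basis sU bU" "card T = Suc (card S)"
  shows "flattening_coefficient sU bU bV bW (pure_tensor u v w) (q, T) (p, S) =
    v (bV p) * (w (bW q) * wedge_entry (u \<circ> bU) T S)"
  using assms by (simp add: flattening_coefficient_def exterior_flattening_pure_tensor
      wedge_basis_form dual_basis_basis)

text \<open>Duality leaves only the basis tensors with second index p and third index q; the
  remaining sum over i reassembles by linearity of \<open>wedge_entry\<close> in the linear
  form.\<close>

lemma eval_flattening_matrix:
  fixes bU :: "'m::{finite,linorder} \<Rightarrow> 'u::ab_group_add" and bV :: "'n::finite \<Rightarrow> 'v::ab_group_add"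
    and bW :: "'k::finite \<Rightarrow> 'w::ab_group_add"
  assumes bases: "is_basis sU bU" "is_basis sV bV" "is_basis sW bW"
    and card: "card T = Suc (card S)"
  shows "mpoly_eval (flattening_matrix sU sV sW bU bV bW (q, T) (p, S)) (coords bU bV bW x) =
    wedge_entry (\<lambda>i. x (bU i) (bV p) (bW q)) T S"
proof -
  have "mpoly_eval (flattening_matrix sU sV sW bU bV bW (q, T) (p, S)) (coords bU bV bW x) =
      (\<Sum>(i, p', q')\<in>UNIV. (if p = p' then 1 else 0) * ((if q = q' then 1 else 0) *
        wedge_entry (dual_basis sU bU i \<circ> bU) T S) * x (bU i) (bV p') (bW q'))"
    by (simp add: flattening_matrix_def mpoly_eval_sum mpoly_eval_mult mpoly_eval_const
        mpoly_eval_var coords_def flattening_coefficient_pure_tensor[OF bases(1) card]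
        dual_basis_basis[OF bases(2)] dual_basis_basis[OF bases(3)] case_prod_unfold)
  also have "\<dots> = (\<Sum>i\<in>UNIV. wedge_entry (dual_basis sU bU i \<circ> bU) T S * x (bU i) (bV p) (bW q))"
  proof -
    have "(\<Sum>(i, p', q')\<in>UNIV. (if p = p' then 1 else 0) * ((if q = q' then 1 else 0) *
        wedge_entry (dual_basis sU bU i \<circ> bU) T S) * x (bU i) (bV p') (bW q')) =
      (\<Sum>i\<in>UNIV. \<Sum>p'\<in>UNIV. \<Sum>q'\<in>UNIV. if q = q' then (if p = p' then
        wedge_entry (dual_basis sU bU i \<circ> bU) T S * x (bU i) (bV p') (bW q') else 0) else 0)"
      unfolding sum.cartesian_product UNIV_Times_UNIV by (rule sum.cong) auto
    then show ?thesis by simp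
  qed
  also have "\<dots> = (\<Sum>t\<in>T. \<Sum>i\<in>UNIV. if t = i then
      (if T - {t} = S then (-1) ^ card {y \<in> T. y < t} * x (bU t) (bV p) (bW q) else 0) else 0)"
    unfolding wedge_entry_def sum_distrib_right
    by (subst sum.swap, intro sum.cong refl) (simp add: dual_basis_basis[OF bases(1)])
  also have "\<dots> = wedge_entry (\<lambda>i. x (bU i) (bV p) (bW q)) T S"
    by (simp add: wedge_entry_def)
  finally show ?thesis .
qed

lemma wedge_entry_sum:
  "wedge_entry (\<lambda>i. \<Sum>l\<in>L. u l i * z l) T S = (\<Sum>l\<in>L. wedge_entry (u l) T S * z l)"
proof -
  have "(\<Sum>l\<in>L. wedge_entry (u l) T S * z l) = (\<Sum>t\<in>T. \<Sum>l\<in>L.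
      (if T - {t} = S then (-1) ^ card {x \<in> T. x < t} * u l t else 0) * z l)"
    unfolding wedge_entry_def sum_distrib_right by (rule sum.swap)
  also have "\<dots> = wedge_entry (\<lambda>i. \<Sum>l\<in>L. u l i * z l) T S"
    unfolding wedge_entry_def by (auto simp: sum_distrib_left sum_distrib_right mult_ac intro!: sum.cong)
  finally show ?thesis by simp
qed

text \<open>Each pure summand factors through at most (m - 1 choose j) coordinates by
  \<open>wedge_entry_factors\<close>, so the whole flattening factors through at most s times as
  many, fewer than N.\<close>

lemma eval_minor_eq_0:
  fixes bU :: "'m::{finite,linorder} \<Rightarrow> 'u::ab_group_add" and bV :: "'n::finite \<Rightarrow> 'v::ab_group_add"
    and bW :: "'k::finite \<Rightarrow> 'w::ab_group_add"
  assumes bases: "is_basis sU bU" "is_basis sV bV" "is_basis sW bW"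
    and x: "x = (\<lambda>a b c. \<Sum>l<s. pure_tensor (u l) (v l) (w l) a b c)"
    and N: "s * ((CARD('m) - 1) choose j) < N"
    and f: "f \<in> minors N (UNIV \<times> {T. card T = j + 1}) (UNIV \<times> {S. card S = j})
      (flattening_matrix sU sV sW bU bV bW)"
  shows "mpoly_eval f (coords bU bV bW x) = 0"
proof -
  obtain rs cs where f_eq: "f = Determinant.det (mat N N (\<lambda>(p, q).
      flattening_matrix sU sV sW bU bV bW (rs ! p) (cs ! q)))"
    and rs: "length rs = N" "set rs \<subseteq> UNIV \<times> {T. card T = j + 1}"
    and cs: "length cs = N" "set cs \<subseteq> UNIV \<times> {S. card S = j}"
    using f unfolding minors_def by blast
  have "\<exists>G \<beta>. card G \<le> (CARD('m) - 1) choose j \<and> (\<forall>T S. card S = j \<longrightarrow>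
      wedge_entry (u l \<circ> bU) T S = (\<Sum>S'\<in>G. wedge_entry (u l \<circ> bU) T S' * \<beta> S' S))" for l
    by (rule wedge_entry_factors[of j "u l \<circ> bU"]) blast
  then obtain G \<beta> where G: "\<And>l. card (G l) \<le> (CARD('m) - 1) choose j"
    and \<beta>: "\<And>l T S. card S = j \<Longrightarrow> wedge_entry (u l \<circ> bU) T S =
      (\<Sum>S'\<in>G l. wedge_entry (u l \<circ> bU) T S' * \<beta> l S' S)"
    by metis
  \<comment> \<open>The disjoint union of the index sets of the s summands.\<close>
  define K where "K = Sigma {..<s} G"
  have "card K = (\<Sum>l<s. card (G l))"
    unfolding K_def by (rule card_SigmaI) auto
  also have "\<dots> \<le> (\<Sum>l<s. (CARD('m) - 1) choose j)"
    by (rule sum_mono) (rule G)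
  finally have K: "finite K" "card K < N"
    using N by (auto simp: K_def)
  \<comment> \<open>All that depends on the row (q, T) goes into \<alpha>, and all that depends on
    the column (p, S) into \<gamma>.\<close>
  define \<alpha> where "\<alpha> k = (\<lambda>(l, S') (q, T). w l (bW q) * wedge_entry (u l \<circ> bU) T S') k"
    for k :: "nat \<times> 'm set"
  define \<gamma> where "\<gamma> k = (\<lambda>(l, S') (p, S). v l (bV p) * \<beta> l S' S) k" for k :: "nat \<times> 'm set"
  have entry: "mpoly_eval (flattening_matrix sU sV sW bU bV bW (q, T) (p, S)) (coords bU bV bW x) =
      (\<Sum>k\<in>K. \<alpha> k (q, T) * \<gamma> k (p, S))"
    if "card T = j + 1" "card S = j" for q T p S
  proof -
    have "mpoly_eval (flattening_matrix sU sV sW bU bV bW (q, T) (p, S)) (coords bU bV bW x) =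
        wedge_entry (\<lambda>i. \<Sum>l<s. (u l \<circ> bU) i * (v l (bV p) * w l (bW q))) T S"
      using that by (simp add: eval_flattening_matrix[OF bases] x pure_tensor_def mult_ac)
    also have "\<dots> = (\<Sum>l<s. wedge_entry (u l \<circ> bU) T S * (v l (bV p) * w l (bW q)))"
      by (rule wedge_entry_sum)
    also have "\<dots> = (\<Sum>l<s. \<Sum>S'\<in>G l. \<alpha> (l, S') (q, T) * \<gamma> (l, S') (p, S))"
      by (subst \<beta>[OF that(2)])
        (simp add: sum_distrib_left sum_distrib_right \<alpha>_def \<gamma>_def mult_ac)
    also have "\<dots> = (\<Sum>k\<in>K. \<alpha> k (q, T) * \<gamma> k (p, S))"
      unfolding K_def by (subst sum.Sigma) (auto intro!: sum.cong)
    finally show ?thesis .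
  qed
  have "Determinant.det (mat N N (\<lambda>pq. mpoly_eval (case pq of (p, q) \<Rightarrow>
      flattening_matrix sU sV sW bU bV bW (rs ! p) (cs ! q)) (coords bU bV bW x))) = 0"
  proof (rule det_eq_0_if_factors[OF K])
    fix p q assume pq: "p < N" "q < N"
    obtain y T where T: "rs ! p = (y, T)" "card T = j + 1"
      using rs nth_mem[of p rs] pq by fastforce
    obtain z S where S: "cs ! q = (z, S)" "card S = j"
      using cs nth_mem[of q cs] pq by fastforce
    show "mpoly_eval (case (p, q) of (p, q) \<Rightarrow>
        flattening_matrix sU sV sW bU bV bW (rs ! p) (cs ! q)) (coords bU bV bW x) =
        (\<Sum>k\<in>K. \<alpha> k (rs ! p) * \<gamma> k (cs ! q))"
      by (simp add: T S entry)
  qed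
  then show ?thesis
    by (simp add: f_eq mpoly_eval_det)
qed

text \<open>Needed because \<open>zariski_closed\<close> admits only homogeneous equations.\<close>

lemma homogeneous_minor:
  fixes bU :: "'m::{finite,linorder} \<Rightarrow> 'u::ab_group_add" and bV :: "'n::finite \<Rightarrow> 'v::ab_group_add"
    and bW :: "'k::finite \<Rightarrow> 'w::ab_group_add"
  assumes "f \<in> minors N A B (flattening_matrix sU sV sW bU bV bW)"
  shows "homogeneous f"
proof -
  have "homogeneous_of_degree 1 (flattening_matrix sU sV sW bU bV bW R C)" for R C
    unfolding flattening_matrix_def case_prod_unfold
    by (intro homogeneous_of_degree_sum homogeneous_linear_form)
  then have "homogeneous_of_degree N (Determinant.det (mat N N (\<lambda>(p, q).
      flattening_matrix sU sV sW bU bV bW (rs ! p) (cs ! q))))" for rs cs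
    by (intro homogeneous_det) (simp add: case_prod_unfold)
  then show ?thesis
    using assms by (auto simp: minors_def homogeneous_def)
qed

text \<open>The zero locus of the minor is closed, so it contains the closure once it contains all
  points of rank at most r.\<close>

lemma minor_vanishes_on_secant_variety:
  fixes bU :: "'m::{finite,linorder} \<Rightarrow> 'u::ab_group_add" and bV :: "'n::finite \<Rightarrow> 'v::ab_group_add"
    and bW :: "'k::finite \<Rightarrow> 'w::ab_group_add"
  assumes bases: "is_basis sU bU" "is_basis sV bV" "is_basis sW bW"
    and f: "f \<in> minors (r * ((CARD('m) - 1) choose j) + 1)
      (UNIV \<times> {T. card T = j + 1}) (UNIV \<times> {S. card S = j})
      (flattening_matrix sU sV sW bU bV bW)"
  shows "f \<in> vanishing_ideal bU bV bW (secant_variety_segre sU sV sW bU bV bW r)"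
proof -
  let ?X = "line_through ` {x \<in> tensor_space sU sV sW.
    x \<noteq> (\<lambda>a b c. 0) \<and> tensor_rank sU sV sW x \<le> r}"
  define Z where "Z = {P \<in> projective_space sU sV sW. vanishes_at bU bV bW f P}"
  have "zariski_closed sU sV sW bU bV bW Z"
    unfolding zariski_closed_def Z_def
    by (intro exI[of _ "{f}"]) (use homogeneous_minor[OF f] in auto)
  moreover have "?X \<subseteq> Z"
  proof
    fix P assume "P \<in> ?X"
    then obtain x where P: "P = line_through x" and x: "x \<in> tensor_space sU sV sW"
      "x \<noteq> (\<lambda>a b c. 0)" "tensor_rank sU sV sW x \<le> r"
      by auto
    obtain u v w where uvw: "x = (\<lambda>a b c. \<Sum>l<tensor_rank sU sV sW x.
        pure_tensor (u l) (v l) (w l) a b c)"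
      using is_sum_of_pure_tensors_tensor_rank[OF bases x(1)]
      unfolding is_sum_of_pure_tensors_def by blast
    \<comment> \<open>Vanishing at a projective point is tested on the whole line. The scalar goes
      into the first factors, so the number of summands does not grow.\<close>
    have "mpoly_eval f (coords bU bV bW (\<lambda>a b c. z * x a b c)) = 0" for z
    proof (rule eval_minor_eq_0[OF bases _ _ f])
      show "(\<lambda>a b c. z * x a b c) = (\<lambda>a b c. \<Sum>l<tensor_rank sU sV sW x.
          pure_tensor (\<lambda>a. z * u l a) (v l) (w l) a b c)"
        by (subst uvw) (simp add: pure_tensor_def sum_distrib_left mult_ac)
      show "tensor_rank sU sV sW x * ((CARD('m) - 1) choose j) < r * ((CARD('m) - 1) choose j) + 1"
        using mult_le_mono1[OF x(3), of "(CARD('m) - 1) choose j"] by linarith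
    qed
    then show "P \<in> Z"
      using x by (auto simp: Z_def P projective_space_def vanishes_at_def line_through_def)
  qed
  ultimately have "secant_variety_segre sU sV sW bU bV bW r \<subseteq> Z"
    unfolding secant_variety_segre_def zariski_closure_def by blast
  then show ?thesis
    by (auto simp: vanishing_ideal_def Z_def)
qed

theorem proposition2p5:
  fixes sU :: "complex \<Rightarrow> 'u::ab_group_add \<Rightarrow> 'u"
    and sV :: "complex \<Rightarrow> 'v::ab_group_add \<Rightarrow> 'v"
    and sW :: "complex \<Rightarrow> 'w::ab_group_add \<Rightarrow> 'w"
    and bU :: "'m::{finite,linorder} \<Rightarrow> 'u"
    and bV :: "'n::finite \<Rightarrow> 'v"
    and bW :: "'k::finite \<Rightarrow> 'w"
    and r :: nat
    and c :: "nat \<Rightarrow> nat"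
  assumes "is_basis sU bU" and "is_basis sV bV" and "is_basis sW bW"
    and "r \<ge> 1"
    and "\<And>j. j \<le> CARD('m) - 1 \<Longrightarrow> c j = r * ((CARD('m) - 1) choose j)"
  shows "subscheme_contained
    (reduced_subscheme bU bV bW (secant_variety_segre sU sV sW bU bV bW r))
    (flattening_subscheme sU sV sW bU bV bW c)"
proof -
  let ?J = "vanishing_ideal bU bV bW (secant_variety_segre sU sV sW bU bV bW r)"
  have "flattening_ideal_at sU sV sW bU bV bW j (c j) \<subseteq> ?J" if "j < CARD('m)" for j
  proof -
    \<comment> \<open>The ideal ranges over j < m, which is the range j \<le> m - 1 where c is
      prescribed.\<close>
    have "c j = r * ((CARD('m) - 1) choose j)"
      using that by (intro assms(5)) simp
    then show ?thesis
      unfolding flattening_ideal_at_def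
      by (intro ideal_generated_subset_vanishing_ideal subsetI
          minor_vanishes_on_secant_variety[OF assms(1-3)]) simp
  qed
  then have "flattening_ideal sU sV sW bU bV bW c \<subseteq> ?J"
    unfolding flattening_ideal_def by (intro ideal_generated_subset_vanishing_ideal) blast
  \<comment> \<open>Containment of subschemes reverses inclusion of saturated ideals, so it suffices
    to compare the ideals before saturation.\<close>
  then show ?thesis
    unfolding subscheme_contained_def reduced_subscheme_def flattening_subscheme_def
      subscheme_defined_by_def by (rule saturation_mono)
qed

end
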